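(* Let $X$ be a Banach space and let $S=(X;X_k,k\geqslant 1)$ be a system of closed linear subspaces of $X$ which is a representing system of subspaces in $X$. Then there exists $\varepsilon>0$ such that for every sequential partition $\pi$ of $\mathbb{N}$ one has $$F_1(S,\pi,\varphi)\geqslant\varepsilon\|\varphi\|\quad\text{for all }\varphi\in X^*.$$
   Context: $X$ is a Banach space over $\mathbb{K}$ ($=\mathbb{R}$ or $\mathbb{C}$), $X^*$ is its dual, $\mathbb{N}=\{1,2,\ldots\}$. "Subspace" means closed linear subset. A system $S=(X;X_k,k\geqslant 1)$ of subspaces $X_1,X_2,\ldots$ of $X$ is a representing system of subspaces in $X$ if every $x\in X$ can be written as a norm-convergent series $x=\sum_{k=1}^\infty x_k$ with $x_k\in X_k$, $k\geqslant 1$. For nonempty $I\subset\mathbb{N}$, $S^{(I)}$ is the closure of the linear span of the subspaces $X_i$, $i\in I$; for $\varphi\in X^*$, $\varphi^{(S,I)}\in (S^{(I)})^*$ is the restriction of $\varphi$ to $S^{(I)}$. For a partition $\pi=\{I_k\}$ of $\mathbb{N}$ (into finitely or countably many sets), $F_1(S,\pi,\varphi)=\sum_k\|\varphi^{(S,I_k)}\|$ (possibly $+\infty$), $\varphi\in X^*$. A partition $\pi$ of $\mathbb{N}$ is called sequential if it has one of the following two forms: (1) $\pi=\{I_k\}_{k\geqslant1}$ with $I_k=\{n(k-1)+1,\ldots,n(k)\}$, $k\geqslant 1$, for some infinite increasing sequence of natural numbers $n(1)<n(2)<\ldots$, with $n(0)=0$; (2) $\pi=\{I_1,\ldots,I_{p+1}\}$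 with $I_k=\{n(k-1)+1,\ldots,n(k)\}$ for $1\leqslant k\leqslant p$ and $I_{p+1}=\{n(p)+1,n(p)+2,\ldots\}$, for some finite increasing sequence of natural numbers $n(1)<\ldots<n(p)$, with $n(0)=0$. *)

theory Defs
  imports "HOL-Analysis.Analysis"
begin

(* A normed space over K = R or C.  The library has no class of complex normed spaces, so scalar
   multiplication by K is carried explicitly on top of the underlying real normed space.
   By the theorem of Gelfand and Mazur, real and complex are up to isometric isomorphism
   the only instances of real_normed_field. *)
locale normed_space_over = vector_space smul
  for smul :: "'k::real_normed_field \<Rightarrow> 'a::real_normed_vector \<Rightarrow> 'a" +
  assumes smul_of_real: "smul (of_real r) x = r *\<^sub>R x"
    and norm_smul: "norm (smul c x) = norm c * norm x"

lemma normed_space_over_real: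
  "normed_space_over ((*\<^sub>R) :: real \<Rightarrow> 'a \<Rightarrow> 'a::real_normed_vector)"
  by unfold_locales (simp_all add: scaleR_add_right scaleR_add_left)

lemma normed_space_over_self:
  "normed_space_over ((*) :: 'k \<Rightarrow> 'k \<Rightarrow> 'k::real_normed_field)"
  by unfold_locales (simp_all add: algebra_simps scaleR_conv_of_real norm_mult)

definition dual_space ::
    "('k::real_normed_field \<Rightarrow> 'a::real_normed_vector \<Rightarrow> 'a) \<Rightarrow> ('a \<Rightarrow> 'k) set" where
  "dual_space smul = {\<phi>. Vector_Spaces.linear smul (*) \<phi> \<and> bounded_linear \<phi>}"

(* The norm of the restriction of f to the subspace M; for M = UNIV this is onorm.
   The point x = 0 contributes 0 / 0 = 0. *)
definition onorm_on :: "'a::real_normed_vector set \<Rightarrow> ('a \<Rightarrow> 'b::real_normed_vector) \<Rightarrow> real" where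
  "onorm_on M f = (SUP x\<in>M. norm (f x) / norm x)"

lemma onorm_on_UNIV: "onorm_on UNIV f = onorm f"
  by (simp add: onorm_on_def onorm_def)

(* Systems of subspaces are indexed by k >= 1; the value X 0 is irrelevant throughout. *)
definition subspace_system ::
    "('k::real_normed_field \<Rightarrow> 'a::real_normed_vector \<Rightarrow> 'a) \<Rightarrow> (nat \<Rightarrow> 'a set) \<Rightarrow> bool" where
  "subspace_system smul X \<longleftrightarrow> (\<forall>k\<ge>1. module.subspace smul (X k) \<and> closed (X k))"

definition representing_system ::
    "('k::real_normed_field \<Rightarrow> 'a::real_normed_vector \<Rightarrow> 'a) \<Rightarrow> (nat \<Rightarrow> 'a set) \<Rightarrow> bool" where
  "representing_system smul X \<longleftrightarrow> subspace_system smul X \<and>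
     (\<forall>v. \<exists>x. (\<forall>k\<ge>1. x k \<in> X k) \<and> (\<lambda>k. x (Suc k)) sums v)"

definition closed_span ::
    "('k::real_normed_field \<Rightarrow> 'a::real_normed_vector \<Rightarrow> 'a) \<Rightarrow> (nat \<Rightarrow> 'a set) \<Rightarrow> nat set \<Rightarrow> 'a set" where
  "closed_span smul X I = closure (module.span smul (\<Union>i\<in>I. X i))"

(* A partition is the set of its blocks; as the terms are nonnegative, the order of summation
   does not matter, and the value may be infinite. *)
definition F1 ::
    "('k::real_normed_field \<Rightarrow> 'a::real_normed_vector \<Rightarrow> 'a) \<Rightarrow> (nat \<Rightarrow> 'a set) \<Rightarrow>
      nat set set \<Rightarrow> ('a \<Rightarrow> 'k) \<Rightarrow> ennreal" where
  "F1 smul X \<pi> \<phi> = (\<Sum>\<^sub>\<infinity>I\<in>\<pi>. ennreal (onorm_on (closed_span smul X I) \<phi>))"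

definition sequential_partition :: "nat set set \<Rightarrow> bool" where
  "sequential_partition \<pi> \<longleftrightarrow>
     (\<exists>n::nat \<Rightarrow> nat. n 0 = 0 \<and> strict_mono n \<and> \<pi> = (\<lambda>k. {n (k - 1) + 1..n k}) ` {1..}) \<or>
     (\<exists>(n::nat \<Rightarrow> nat) p. p \<ge> 1 \<and> n 0 = 0 \<and> strict_mono_on {0..p} n \<and>
        \<pi> = insert {n p + 1..} ((\<lambda>k. {n (k - 1) + 1..n k}) ` {1..p}))"

lemma partition_on_sequential_partition:
  assumes "sequential_partition \<pi>"
  shows "partition_on {1..} \<pi>"
proof -
  have blk: "\<exists>k\<in>{1..p}. x \<in> {n (k - 1) + 1..n k}"
    if "n 0 = 0" "1 \<le> x" "x \<le> n p" for n :: "nat \<Rightarrow> nat" and p x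
  proof -
    define k where "k = (LEAST k. x \<le> n k)"
    have k: "x \<le> n k" "k \<le> p"
      unfolding k_def using that(3) by (auto intro: LeastI Least_le)
    with that have "k > 0" by (cases k) auto
    then have "\<not> x \<le> n (k - 1)"
      unfolding k_def by (intro not_less_Least) simp
    with k \<open>k > 0\<close> show ?thesis by (intro bexI[of _ k]) auto
  qed
  have dis: "disjnt {n (j - 1) + 1..n j} {n (k - 1) + 1..n k}"
    if "j < k" "n j \<le> n (k - 1)" for n :: "nat \<Rightarrow> nat" and j k
    using that by (auto simp: disjnt_def)
  from assms consider
      (inf) n :: "nat \<Rightarrow> nat" where "n 0 = 0" "strict_mono n" "\<pi> = (\<lambda>k. {n (k - 1) + 1..n k}) ` {1..}"
    | (fin) n :: "nat \<Rightarrow> nat" and p where "p \<ge> 1" "n 0 = 0" "strict_mono_on {0..p} n"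
        "\<pi> = insert {n p + 1..} ((\<lambda>k. {n (k - 1) + 1..n k}) ` {1..p})"
    unfolding sequential_partition_def by (elim disjE exE conjE) (rule that; assumption)+
  then show ?thesis
  proof cases
    case inf
    have le: "n i \<le> n j" if "i \<le> j" for i j
      using inf(2) that by (simp add: strict_mono_less_eq)
    show ?thesis
    proof (rule partition_onI)
      show "\<Union>\<pi> = {1..}"
      proof (intro equalityI subsetI)
        fix x assume "x \<in> {1::nat..}"
        then have "\<exists>k\<in>{1..x}. x \<in> {n (k - 1) + 1..n k}"
          using blk[of n x x] inf(1) strict_mono_imp_increasing[OF inf(2), of x] by simp
        then show "x \<in> \<Union>\<pi>" unfolding inf(3) by fastforce
      qed (auto simp: inf(3))
    next
      fix A B assume AB: "A \<in> \<pi>" "B \<in> \<pi>" "A \<noteq> B"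
      from AB obtain j k where jk: "A = {n (j - 1) + 1..n j}" "B = {n (k - 1) + 1..n k}" "j \<noteq> k"
        unfolding inf(3) by blast
      show "disjnt A B"
      proof (cases "j < k")
        case True
        then show ?thesis using dis[of j k n, OF True le] jk(1,2) by simp
      next
        case False
        then show ?thesis using dis[of k j n, OF _ le] jk by (simp add: disjnt_sym)
      qed
    next
      show "{} \<notin> \<pi>"
      proof
        assume "{} \<in> \<pi>"
        then obtain k where k: "k \<ge> 1" "{n (k - 1) + 1..n k} = {}" unfolding inf(3) by force
        then have "n (k - 1) < n k" using inf(2) by (simp add: strict_mono_less)
        with k show False by simp
      qed
    qed
  next
    case fin
    have lt: "n i < n j" if "i < j" "j \<le> p" for i j
      using fin(3) that by (auto simp: strict_mono_on_def)
    have le: "n i \<le> n j" if "i \<le> j" "j \<le> p" for i j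
      using lt[of i j] that by (cases "i = j") auto
    show ?thesis
    proof (rule partition_onI)
      show "\<Union>\<pi> = {1..}"
      proof (intro equalityI subsetI)
        fix x assume x: "x \<in> {1::nat..}"
        show "x \<in> \<Union>\<pi>"
        proof (cases "x \<le> n p")
          case True
          then show ?thesis using blk[of n x p] fin(2) x unfolding fin(4) by fastforce
        qed (auto simp: fin(4))
      qed (auto simp: fin(4))
    next
      have 1: "disjnt {n (k - 1) + 1..n k} {n p + 1..}" if "k \<in> {1..p}" for k
        using le[of k p] that by (auto simp: disjnt_def)
      have 2: "disjnt {n (j - 1) + 1..n j} {n (k - 1) + 1..n k}"
        if "j \<in> {1..p}" "k \<in> {1..p}" "j \<noteq> k" for j k
      proof (cases "j < k")
        case True
        then show ?thesis using dis[of j k n, OF True le] that by simp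
      next
        case False
        then show ?thesis using dis[of k j n, OF _ le] that by (simp add: disjnt_sym)
      qed
      define J where "J k = {n (k - 1) + 1..n k}" for k
      fix A B assume AB: "A \<in> \<pi>" "B \<in> \<pi>" "A \<noteq> B"
      have \<pi>: "\<pi> = insert {n p + 1..} (J ` {1..p})" unfolding fin(4) J_def by simp
      have tail: "disjnt (J k) {n p + 1..}" if "k \<in> {1..p}" for k
        unfolding J_def by (rule 1[OF that])
      have blocks: "disjnt (J j) (J k)" if "j \<in> {1..p}" "k \<in> {1..p}" "J j \<noteq> J k" for j k
        unfolding J_def by (rule 2[OF that(1,2)]) (use that(3) in auto)
      from AB(1,2) consider "A = {n p + 1..}" "B = {n p + 1..}"
        | k where "k \<in> {1..p}" "A = {n p + 1..}" "B = J k"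
        | k where "k \<in> {1..p}" "A = J k" "B = {n p + 1..}"
        | j k where "j \<in> {1..p}" "k \<in> {1..p}" "A = J j" "B = J k"
        unfolding \<pi> by (elim insertE imageE) simp_all
      then show "disjnt A B"
      proof cases
        case 1
        then show ?thesis using AB(3) by simp
      next
        case (2 k)
        then show ?thesis using disjnt_sym[OF tail] by simp
      next
        case (3 k)
        then show ?thesis using tail by simp
      next
        case (4 j k)
        then show ?thesis using blocks AB(3) by simp
      qed
    next
      show "{} \<notin> \<pi>"
      proof
        assume "{} \<in> \<pi>"
        then obtain k where k: "1 \<le> k" "k \<le> p" "{n (k - 1) + 1..n k} = {}"
          unfolding fin(4) by force
        with lt[of "k - 1" k] show False by simp
      qed
    qed
  qed
qed

end

theory Submission
  imports Defs
begin

text \<open>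
  For a sequential partition, a convergent representation of \<open>v\<close> is cut into consecutive blocks,
  each a difference of two partial sums (or of \<open>v\<close> and a partial sum). If all partial sums have
  norm at most \<open>M\<close>, every block has norm at most \<open>2 M\<close> and lies in the closed span belonging to
  its index set; applying \<open>\<phi>\<close> and summing gives \<open>\<bar>\<phi> v\<bar> \<le> 2 M F1(\<phi>)\<close>, with a constant that does
  not depend on the partition (\<open>norm_le_F1\<close>).

  A bound \<open>M\<close> that serves a dense set of \<open>v\<close> in some ball comes from the Baire category theorem. The sets \<open>B N\<close> of vectors
  having a representation with partial sums bounded by \<open>N + 1\<close> cover the space, so the closure of some
  \<open>B N\<close> contains a ball (\<open>bounded_reps_somewhere_dense\<close>). The inequality above extends to the
  closure of \<open>B N\<close> by continuity of \<open>\<phi>\<close>, hence holds on that ball, and differences of points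
  of the ball cover a neighbourhood of \<open>0\<close>. Thus one need not know that \<open>B N\<close> itself
  contains a ball, and the iteration in the proof of the open mapping theorem is not needed.
\<close>

section \<open>Norms of restrictions\<close>

lemma norm_quotient_le_onorm_on:
  assumes "bounded_linear f" "x \<in> M"
  shows "norm (f x) / norm x \<le> onorm_on M f"
proof -
  have "bdd_above ((\<lambda>x. norm (f x) / norm x) ` M)"
    using le_onorm[OF assms(1)] by (auto intro!: bdd_aboveI)
  then show ?thesis
    unfolding onorm_on_def by (rule cSUP_upper[OF assms(2)])
qed

lemma onorm_on_nonneg:
  assumes "bounded_linear f" "M \<noteq> {}"
  shows "0 \<le> onorm_on M f"
proof -
  obtain x where "x \<in> M" using assms(2) by blast
  then show ?thesis
    using norm_quotient_le_onorm_on[OF assms(1)] order_trans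
    by (meson divide_nonneg_nonneg norm_ge_zero)
qed

lemma norm_le_onorm_on:
  assumes "bounded_linear f" "x \<in> M"
  shows "norm (f x) \<le> onorm_on M f * norm x"
proof (cases "x = 0")
  case True
  then show ?thesis
    by (simp add: linear_simps(3)[OF assms(1)])
next
  case False
  then show ?thesis
    using norm_quotient_le_onorm_on[OF assms] by (simp add: field_simps)
qed

section \<open>Blocks of a bounded representation\<close>

text \<open>The vectors \<open>x k \<in> X k\<close> represent \<open>v\<close>, and all partial sums have norm at most \<open>M\<close>.
  Summation starts at \<open>k = 1\<close>, so \<open>x 0\<close> plays no role and the partial sum for \<open>m = 0\<close> is \<open>0\<close>.\<close>

definition bounded_rep :: "(nat \<Rightarrow> 'a set) \<Rightarrow> real \<Rightarrow> 'a::real_normed_vector \<Rightarrow> (nat \<Rightarrow> 'a) \<Rightarrow> bool"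
  where "bounded_rep X M v x \<longleftrightarrow> (\<forall>k\<ge>1. x k \<in> X k) \<and>
    (\<lambda>m. \<Sum>k=1..m. x k) \<longlonglongrightarrow> v \<and> (\<forall>m. norm (\<Sum>k=1..m. x k) \<le> M)"

lemma sum_interval_diff:
  fixes x :: "nat \<Rightarrow> 'a::ab_group_add"
  assumes "a \<le> b"
  shows "(\<Sum>k=1..b. x k) - (\<Sum>k=1..a. x k) = (\<Sum>k=a+1..b. x k)"
  using sum.ub_add_nat[of 1 a x "b - a"] assms by simp

context normed_space_over
begin

lemma sum_in_closed_span:
  assumes "\<And>k. k \<in> J \<Longrightarrow> x k \<in> X k" "J \<subseteq> I"
  shows "(\<Sum>k\<in>J. x k) \<in> closed_span smul X I"
proof -
  have "(\<Sum>k\<in>J. x k) \<in> span (\<Union>i\<in>I. X i)"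
    using assms by (blast intro: span_sum span_base)
  then show ?thesis
    unfolding closed_span_def using closure_subset by blast
qed

lemma closed_span_nonempty: "closed_span smul X I \<noteq> {}"
  using sum_in_closed_span[of "{}" _ X I] by auto

lemma block_estimate:
  assumes "bounded_linear \<phi>" "bounded_rep X M v x" "a \<le> b"
  shows "norm (\<phi> (\<Sum>k=1..b. x k) - \<phi> (\<Sum>k=1..a. x k))
    \<le> 2 * M * onorm_on (closed_span smul X {a + 1..b}) \<phi>"
proof -
  let ?d = "(\<Sum>k=1..b. x k) - (\<Sum>k=1..a. x k)"
  let ?C = "closed_span smul X {a + 1..b}"
  have "?d \<in> ?C"
    unfolding sum_interval_diff[OF assms(3)]
    by (rule sum_in_closed_span) (use assms(2) in \<open>auto simp: bounded_rep_def\<close>)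
  then have "norm (\<phi> ?d) \<le> onorm_on ?C \<phi> * norm ?d"
    by (rule norm_le_onorm_on[OF assms(1)])
  also have "norm ?d \<le> M + M"
    by (rule norm_triangle_le_diff, rule add_mono) (use assms(2) in \<open>auto simp: bounded_rep_def\<close>)
  then have "onorm_on ?C \<phi> * norm ?d \<le> onorm_on ?C \<phi> * (M + M)"
    by (rule mult_left_mono) (rule onorm_on_nonneg[OF assms(1) closed_span_nonempty])
  finally show ?thesis
    by (simp add: linear_simps(2)[OF assms(1)] mult.commute)
qed

lemma tail_estimate:
  assumes "bounded_linear \<phi>" "bounded_rep X M v x"
  shows "norm (\<phi> v - \<phi> (\<Sum>k=1..a. x k))
    \<le> 2 * M * onorm_on (closed_span smul X {a + 1..}) \<phi>"
proof -
  let ?T = "\<lambda>m. \<Sum>k=1..m. x k"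
  let ?C = "closed_span smul X {a + 1..}"
  have lim: "(\<lambda>m. ?T (m + a) - ?T a) \<longlonglongrightarrow> v - ?T a"
    by (rule tendsto_diff[OF LIMSEQ_ignore_initial_segment tendsto_const])
      (use assms(2) in \<open>simp add: bounded_rep_def\<close>)
  have mem: "?T (m + a) - ?T a \<in> ?C" for m
    unfolding sum_interval_diff[OF le_add2]
    by (rule sum_in_closed_span) (use assms(2) in \<open>auto simp: bounded_rep_def\<close>)
  have "closed ?C"
    by (simp add: closed_span_def)
  then have "v - ?T a \<in> ?C"
    by (rule closed_sequentially[OF _ mem lim])
  then have "norm (\<phi> (v - ?T a)) \<le> onorm_on ?C \<phi> * norm (v - ?T a)"
    by (rule norm_le_onorm_on[OF assms(1)])
  also have "norm (?T (m + a) - ?T a) \<le> M + M" for m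
    by (rule norm_triangle_le_diff, rule add_mono) (use assms(2) in \<open>auto simp: bounded_rep_def\<close>)
  then have "norm (v - ?T a) \<le> M + M"
    by (intro LIMSEQ_le_const2[OF tendsto_norm[OF lim]]) blast
  then have "onorm_on ?C \<phi> * norm (v - ?T a) \<le> onorm_on ?C \<phi> * (M + M)"
    by (rule mult_left_mono) (rule onorm_on_nonneg[OF assms(1) closed_span_nonempty])
  finally show ?thesis
    by (simp add: linear_simps(2)[OF assms(1)] mult.commute)
qed

lemma norm_partial_sum_le:
  fixes n :: "nat \<Rightarrow> nat"
  assumes "bounded_linear \<phi>" "bounded_rep X M v x" "n 0 = 0" "mono_on {0..p} n"
  shows "norm (\<phi> (\<Sum>k=1..n p. x k))
    \<le> 2 * M * (\<Sum>k=1..p. onorm_on (closed_span smul X {n (k - 1) + 1..n k}) \<phi>)"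
  using assms(4)
proof (induction p)
  case 0
  then show ?case
    by (simp add: assms(3) linear_simps(3)[OF assms(1)])
next
  case (Suc p)
  have "norm (\<phi> (\<Sum>k=1..n p. x k))
    \<le> 2 * M * (\<Sum>k=1..p. onorm_on (closed_span smul X {n (k - 1) + 1..n k}) \<phi>)"
    by (rule Suc.IH) (rule mono_on_subset[OF Suc.prems], auto)
  moreover have "norm (\<phi> (\<Sum>k=1..n (Suc p). x k) - \<phi> (\<Sum>k=1..n p. x k))
    \<le> 2 * M * onorm_on (closed_span smul X {n p + 1..n (Suc p)}) \<phi>"
    by (rule block_estimate[OF assms(1,2)]) (use mono_onD[OF Suc.prems, of p "Suc p"] in simp)
  moreover have "norm (\<phi> (\<Sum>k=1..n (Suc p). x k)) \<le> norm (\<phi> (\<Sum>k=1..n p. x k))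
      + norm (\<phi> (\<Sum>k=1..n (Suc p). x k) - \<phi> (\<Sum>k=1..n p. x k))"
    by (rule norm_triangle_sub)
  ultimately show ?case
    by (simp add: distrib_left)
qed

end

text \<open>\<open>F1\<close> sums over the set of blocks; distinct indices give distinct blocks because all blocks
  are nonempty, so this agrees with the sum over indices.\<close>

lemma inj_on_blocks:
  fixes n :: "nat \<Rightarrow> nat"
  assumes "strict_mono_on {0..p} n"
  shows "inj_on (\<lambda>k. {n (k - 1) + 1..n k}) {1..p}"
proof (rule inj_onI)
  fix i j assume ij: "i \<in> {1..p}" "j \<in> {1..p}" "{n (i - 1) + 1..n i} = {n (j - 1) + 1..n j}"
  have "n (k - 1) < n k" if "k \<in> {1..p}" for k
    using that assms by (auto simp: strict_mono_on_def)
  with ij have "n i = n j"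
    by (metis Icc_eq_Icc Suc_eq_plus1 Suc_leI)
  with ij(1,2) show "i = j"
    using strict_mono_on_imp_inj_on[OF assms] by (auto dest: inj_onD)
qed

lemma sum_le_F1:
  assumes "finite F" "F \<subseteq> \<pi>"
  shows "(\<Sum>I\<in>F. ennreal (onorm_on (closed_span smul X I) \<phi>)) \<le> F1 smul X \<pi> \<phi>"
  unfolding F1_def by (subst nonneg_infsum_complete) (use assms in \<open>auto intro: SUP_upper\<close>)

lemma (in normed_space_over) norm_le_F1:
  assumes "bounded_linear \<phi>" "bounded_rep X M v x" "0 \<le> M" "sequential_partition \<pi>"
  shows "ennreal (norm (\<phi> v)) \<le> ennreal (2 * M) * F1 smul X \<pi> \<phi>"
proof -
  let ?c = "\<lambda>I. onorm_on (closed_span smul X I) \<phi>"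
  let ?T = "\<lambda>m. \<Sum>k=1..m. x k"
  have c: "0 \<le> ?c I" for I
    by (rule onorm_on_nonneg[OF assms(1) closed_span_nonempty])
  have finite_bound: "ennreal r \<le> ennreal (2 * M) * F1 smul X \<pi> \<phi>"
    if "r \<le> 2 * M * (\<Sum>I\<in>F. ?c I)" "finite F" "F \<subseteq> \<pi>" for r F
  proof -
    have "ennreal r \<le> ennreal (2 * M) * ennreal (\<Sum>I\<in>F. ?c I)"
      using that(1) assms(3) c by (simp add: sum_nonneg ennreal_leI flip: ennreal_mult)
    also have "\<dots> = ennreal (2 * M) * (\<Sum>I\<in>F. ennreal (?c I))"
      using c by (simp add: sum_ennreal)
    also have "\<dots> \<le> ennreal (2 * M) * F1 smul X \<pi> \<phi>"
      by (intro mult_left_mono sum_le_F1 that) simp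
    finally show ?thesis .
  qed
  have blocks: "norm (\<phi> (?T (n p))) \<le> 2 * M * (\<Sum>I\<in>(\<lambda>k. {n (k - 1) + 1..n k}) ` {1..p}. ?c I)"
    if "n 0 = 0" "strict_mono_on {0..p} n" for n :: "nat \<Rightarrow> nat" and p
  proof -
    from norm_partial_sum_le[where n = n, OF assms(1,2) that(1) strict_mono_on_imp_mono_on[OF that(2)]]
    show ?thesis
      by (simp del: One_nat_def add: sum.reindex[OF inj_on_blocks[OF that(2)]])
  qed
  consider (inf) n :: "nat \<Rightarrow> nat" where "n 0 = 0" "strict_mono n"
      "\<pi> = (\<lambda>k. {n (k - 1) + 1..n k}) ` {1..}"
    | (fin) n :: "nat \<Rightarrow> nat" and p where "n 0 = 0" "strict_mono_on {0..p} n"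
      "\<pi> = insert {n p + 1..} ((\<lambda>k. {n (k - 1) + 1..n k}) ` {1..p})"
    using assms(4) unfolding sequential_partition_def by blast
  then show ?thesis
  proof cases
    case inf
    have "ennreal (norm (\<phi> (?T (n p)))) \<le> ennreal (2 * M) * F1 smul X \<pi> \<phi>" for p
      by (rule finite_bound[OF blocks])
        (use inf in \<open>auto simp: strict_mono_on_def strict_mono_def\<close>)
    moreover have "(\<lambda>p. ?T (n p)) \<longlonglongrightarrow> v"
      using assms(2) LIMSEQ_subseq_LIMSEQ[OF _ inf(2)] by (auto simp: bounded_rep_def o_def)
    then have lim: "(\<lambda>p. ennreal (norm (\<phi> (?T (n p))))) \<longlonglongrightarrow> ennreal (norm (\<phi> v))"
      by (intro tendsto_ennrealI tendsto_norm bounded_linear.tendsto[OF assms(1)])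
    ultimately show ?thesis
      by (intro LIMSEQ_le_const2[OF lim]) blast
  next
    case fin
    let ?F = "(\<lambda>k. {n (k - 1) + 1..n k}) ` {1..p}"
    \<comment> \<open>The tail block is infinite, so it is counted separately from the finite blocks.\<close>
    have "{n p + 1..} \<notin> ?F"
      by (metis (no_types, lifting) finite_atLeastAtMost imageE infinite_Ici)
    then have "2 * M * (\<Sum>I\<in>\<pi>. ?c I) = 2 * M * ?c {n p + 1..} + 2 * M * (\<Sum>I\<in>?F. ?c I)"
      unfolding fin(3) by (simp add: distrib_left)
    then have "norm (\<phi> v) \<le> 2 * M * (\<Sum>I\<in>\<pi>. ?c I)"
      using norm_triangle_sub[of "\<phi> v" "\<phi> (?T (n p))"] blocks[OF fin(1,2)]
        tail_estimate[OF assms(1,2), of "n p"] by linarith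
    then show ?thesis
      by (rule finite_bound) (simp_all add: fin(3))
  qed
qed

section \<open>Uniformly bounded representations on a dense part of a ball\<close>

text \<open>The bound is written as \<open>Suc N\<close> to make it positive.\<close>

lemma bounded_rep_exists:
  assumes "representing_system smul X"
  shows "\<exists>N x. bounded_rep X (real (Suc N)) v x"
proof -
  obtain x where x: "\<forall>k\<ge>1. x k \<in> X k" "(\<lambda>k. x (Suc k)) sums v"
    using assms unfolding representing_system_def by blast
  then have lim: "(\<lambda>m. \<Sum>k=1..m. x k) \<longlonglongrightarrow> v"
    by (simp add: sums_def sum.atLeast1_atMost_eq)
  then obtain K where "\<And>m. norm (\<Sum>k=1..m. x k) \<le> K"
    using BseqE[OF convergent_imp_Bseq[OF convergentI[OF lim]]] by blast
  moreover obtain N where "K \<le> real N"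
    using real_arch_simple by blast
  ultimately have "norm (\<Sum>k=1..m. x k) \<le> real (Suc N)" for m
    by (smt (verit) of_nat_Suc)
  with x(1) lim show ?thesis
    unfolding bounded_rep_def by blast
qed

lemma bounded_reps_somewhere_dense:
  fixes X :: "nat \<Rightarrow> 'a::banach set"
  assumes "representing_system smul X"
  obtains N a r where "0 < r" "ball a r \<subseteq> closure {v. \<exists>x. bounded_rep X (real (Suc N)) v x}"
proof -
  define B where "B N = {v. \<exists>x. bounded_rep X (real (Suc N)) v x}" for N
  have "v \<in> (\<Union>N. closure (B N))" for v
  proof -
    obtain N where "v \<in> B N"
      using bounded_rep_exists[OF assms, of v] unfolding B_def by auto
    then have "v \<in> closure (B N)"
      by (rule subsetD[OF closure_subset])
    then show ?thesis
      by (rule UN_I[OF UNIV_I])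
  qed
  then have cover: "(\<Union>N. closure (B N)) = UNIV"
    by blast
  have "\<exists>N. interior (closure (B N)) \<noteq> {}"
  proof (rule ccontr)
    assume empty: "\<nexists>N. interior (closure (B N)) \<noteq> {}"
    have "Met_TC.mcomplete TYPE('a)"
      by (simp add: complete_UNIV)
    then have "Met_TC.mtopology interior_of (\<Union>N. closure (B N)) = {}"
      by (rule Met_TC.metric_Baire_category_alt) (use empty in auto)
    then show False
      unfolding cover by simp
  qed
  then obtain N where "interior (closure (B N)) \<noteq> {}" ..
  then obtain a r where "0 < r" "ball a r \<subseteq> closure (B N)"
    by (metis ex_in_conv mem_interior)
  then show ?thesis
    unfolding B_def by (rule that)
qed

text \<open>The centre of the ball is arbitrary: every vector of norm \<open>r / 2\<close> is the difference of a point
  of the ball and its centre, which costs a factor \<open>2\<close>; rescaling from norm \<open>r / 2\<close> costs \<open>2 / r\<close>.\<close>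

lemma onorm_le_if_bounded_on_ball:
  assumes "bounded_linear f" "0 < r" "\<And>x. x \<in> ball a r \<Longrightarrow> norm (f x) \<le> K"
  shows "onorm f \<le> 4 * K / r"
proof (rule onorm_bound)
  have "norm (f a) \<le> K"
    using assms(2,3) by simp
  then show "0 \<le> 4 * K / r"
    using assms(2) norm_ge_zero[of "f a"] by (smt (verit) divide_nonneg_pos)
  interpret f: bounded_linear f by fact
  show "norm (f u) \<le> 4 * K / r * norm u" for u
  proof (cases "u = 0")
    case True
    then show ?thesis by (simp add: f.zero)
  next
    case False
    define t where "t = r / (2 * norm u)"
    have t: "t > 0" "norm (t *\<^sub>R u) = r / 2"
      using False assms(2) by (auto simp: t_def)
    have "norm (f (a + t *\<^sub>R u)) \<le> K"
      by (rule assms(3)) (use assms(2) t(2) in \<open>simp add: dist_norm\<close>)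
    then have "norm (f (a + t *\<^sub>R u) - f a) \<le> 2 * K"
      using norm_triangle_ineq4[of "f (a + t *\<^sub>R u)" "f a"] \<open>norm (f a) \<le> K\<close> by linarith
    then have "t * norm (f u) \<le> 2 * K"
      using t(1) by (simp add: f.add f.scaleR)
    then show ?thesis
      using False assms(2) by (simp add: t_def field_simps)
  qed
qed

section \<open>The lower bound for \<open>F1\<close>\<close>

theorem mainTheorem1:
  fixes smul :: "'k::real_normed_field \<Rightarrow> 'a::banach \<Rightarrow> 'a"
    and X :: "nat \<Rightarrow> 'a set"
  assumes "normed_space_over smul"
    and "representing_system smul X"
  shows "\<exists>\<epsilon>>0::real. \<forall>\<pi>. sequential_partition \<pi> \<longrightarrow>
           (\<forall>\<phi>\<in>dual_space smul. F1 smul X \<pi> \<phi> \<ge> ennreal (\<epsilon> * onorm \<phi>))"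
proof -
  interpret normed_space_over smul by fact
  obtain N a r where r: "0 < r"
    and dense: "ball a r \<subseteq> closure {v. \<exists>x. bounded_rep X (real (Suc N)) v x}"
    using bounded_reps_somewhere_dense[OF assms(2)] .
  define M where "M = real (Suc N)"
  have M: "0 < M" by (simp add: M_def)
  have "F1 smul X \<pi> \<phi> \<ge> ennreal (r / (8 * M) * onorm \<phi>)"
    if \<pi>: "sequential_partition \<pi>" and \<phi>: "\<phi> \<in> dual_space smul" for \<pi> \<phi>
  \<comment> \<open>If \<open>F1\<close> is infinite the inequality is trivial.\<close>
  proof (cases "F1 smul X \<pi> \<phi>")
    case (real F)
    have lin: "bounded_linear \<phi>"
      using \<phi> by (simp add: dual_space_def)
    have "norm (\<phi> v) \<le> 2 * M * F" if "bounded_rep X M v x" for v x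
      using norm_le_F1[OF lin that _ \<pi>] M real by (simp flip: ennreal_mult)
    then have sub: "{v. \<exists>x. bounded_rep X M v x} \<subseteq> {v. norm (\<phi> v) \<le> 2 * M * F}"
      by blast
    have "closed {v. norm (\<phi> v) \<le> 2 * M * F}"
      by (intro closed_Collect_le continuous_intros bounded_linear.continuous_on[OF lin])
    then have "ball a r \<subseteq> {v. norm (\<phi> v) \<le> 2 * M * F}"
      using dense closure_minimal[OF sub] unfolding M_def by blast
    then have "onorm \<phi> \<le> 4 * (2 * M * F) / r"
      by (intro onorm_le_if_bounded_on_ball[OF lin r]) blast
    then have "r / (8 * M) * onorm \<phi> \<le> F"
      using r M by (simp add: field_simps)
    then show ?thesis
      using real by (simp add: ennreal_leI)
  qed simp
  moreover have "r / (8 * M) > 0"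
    using r M by simp
  ultimately show ?thesis
    by blast
qed

end
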